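(* Let $(\theta,\varphi)$ be a Markov random dynamical system (RDS) over a probability space $(\Omega,\mathcal F,\mathbb P)$ on a countable state space $\mathbb X$, representing an irreducible and positive recurrent Markov chain. Let $A$ be its random attractor and $\kappa$ the $\mathbb P$-a.s. constant size of $A$, and let $\hat\kappa\in\mathbb N\cup\{\infty\}$ be the size of the largest insulated set (all as defined in the context). Then for $\mathbb P$-a.e. $\omega\in\Omega$, the attractor $A(\omega)$ is a maximum insulated set, and hence $\kappa=\hat\kappa$.
   Context: $\mathbb N$ includes $0$. $\mathbb X$ is countable with the discrete topology and the power set $\sigma$-algebra $\mathcal P(\mathbb X)$; compact means finite. RDS: An RDS $(\theta,\varphi)$ on $\mathbb X$ consists of a probability space $(\Omega,\mathcal F,\mathbb P)$; a group $(\theta_n)_{n\in\mathbb Z}$ of bimeasurable measure-preserving maps $\theta_n:\Omega\to\Omega$ with $\theta_0=\mathrm{id}$, $\theta_{n+m}=\theta_n\circ\theta_m$, where $\theta:=\theta_1$ is assumed ergodic with respect to $\mathbb P$; and an $(\mathcal F\otimes\mathcal P(\mathbb N)\otimes\mathcal P(\mathbb X))$-measurable map $\varphi:\Omega\times\mathbb N\times\mathbb X\to\mathbb X$, $(\omega,n,x)\mapsto\varphi^n_\omega(x)$, with $\varphi^0_\omega(x)=x$ and $\varphi^{n+m}_\omega(x)=\varphi^n_{\theta_m\omega}(\varphi^m_\omega(x))$ for all $\omega\in\Omega$, $m,n\in\mathbb N$, $x\in\mathbb X$. Write $\varphi_\omega:=\varphi^1_\omega$; for $K\subset\mathbb X$,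 $\varphi^n_\omega(K)=\{\varphi^n_\omega(x):x\in K\}$. Markov RDS: for $s<t$ in $\mathbb Z$, $\mathcal F_s^t\subset\mathcal F$ is the $\sigma$-algebra generated by the $\mathbb P$-null sets of $\mathcal F$ and the random variables $\omega\mapsto\varphi^n_{\theta_m\omega}(x)$ for $x\in\mathbb X$ and integers $m,n$ with $s\le m\le m+n\le t$. $\mathcal F_{-\infty}^t:=\sigma(\mathcal F_s^t: s<t)$, $\mathcal F_s^\infty:=\sigma(\mathcal F_s^t: t>s)$. The RDS is Markov if $\mathcal F_{-\infty}^0$ and $\mathcal F_0^\infty$ are independent. Then $X_n(\omega)=\varphi^n_\omega(x)$ is a time-homogeneous Markov chain with transition probabilities $P(x,y)=\mathbb P(\varphi_\omega(x)=y)$; the RDS is said to represent this (associated) Markov chain. Compact random set: a map $B:\Omega\to\mathcal P(\mathbb X)$ such that $\omega\mapsto\mathbf 1_{B(\omega)}(x)$ is measurable for each $x$ and $B(\omega)$ is finite for $\mathbb P$-a.e. $\omega$. It is invariant if also $\varphi_\omega(B(\omega))=B(\theta\omega)$ $\mathbb P$-a.s. Random attractor: for an RDS as in the claim there exists an invariant compact random set $A$, unique up to $\mathbb P$-null sets, with $\omega\mapsto \mathbf 1_{A(\omega)}(x)$ being $\mathcal F_{-\infty}^0$-measurable for each $x$, which is a forward attractor for compact random sets, i.e. for each compact random set $B$, $\mathbb P(\exists N\ \forall n\ge N:\varphi^n_\omega(B(\omega))\subset A(\theta_n\omega))=1$, and a pullback attractor for finite deterministic sets, i.e. for each finite $B\subset\mathbb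 X$, $\mathbb P(\exists N\ \forall n\ge N:\varphi^n_{\theta_{-n}\omega}(B)\subset A(\omega))=1$. This $A$ is called the random attractor. There is a constant $\kappa\in\mathbb N_{>0}$ with $|A(\omega)|=\kappa$ for $\mathbb P$-a.e. $\omega$, and $\mathbb P(x\in A(\omega))=\kappa\pi(x)$ for all $x\in\mathbb X$, where $\pi$ is the stationary distribution of the associated Markov chain. Insulated sets: two points $x,y\in\mathbb X$ are insulated, written $x\parallel y$, if $\mathbb P(\varphi^n_\omega(x)=\varphi^n_\omega(y))=0$ for all $n\in\mathbb N$. An insulated set is a set $K\subset\mathbb X$ such that $x\parallel y$ for all distinct $x,y\in K$. $\hat\kappa\in\mathbb N\cup\{\infty\}$ is the size of the largest insulated set. An insulated set $K$ with $|K|=\hat\kappa$ is called a maximum insulated set. *)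

theory Defs
  imports "HOL-Probability.Probability"
begin

text \<open>
  The probability space \<open>(\<Omega>, \<F>, P)\<close> is the measure \<open>M\<close>, so that \<open>\<Omega> = space M\<close> and \<open>\<F> = sets M\<close>;
  all pointwise laws are required on \<open>space M\<close> only.  The countable discrete state space is the
  type \<open>'x\<close>.  We write \<open>\<phi> \<omega> n x\<close> for \<open>\<phi>\<^sup>n\<^sub>\<omega>(x)\<close>.
\<close>

text \<open>The size of a set in \<open>\<nat> \<union> {\<infinity>}\<close>; unlike for \<open>card\<close>, infinite sets have size \<open>\<infinity>\<close>.\<close>

definition set_size :: "'a set \<Rightarrow> enat" where
  "set_size K = (if finite K then enat (card K) else \<infinity>)"

text \<open>
  Bimeasurability of each \<open>\<theta> n\<close> is contained in \<open>theta_measurable\<close>: by the group law the inverse of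
  \<open>\<theta> n\<close> is \<open>\<theta> (- n)\<close>.
\<close>

locale rds = prob_space M
  for M :: "'w measure" +
  fixes \<theta> :: "int \<Rightarrow> 'w \<Rightarrow> 'w"
    and \<phi> :: "'w \<Rightarrow> nat \<Rightarrow> 'x::countable \<Rightarrow> 'x"
  assumes theta_measurable: "\<And>n. \<theta> n \<in> measurable M M"
    and theta_preserving: "\<And>n. distr M M (\<theta> n) = M"
    and theta_zero: "\<And>\<omega>. \<omega> \<in> space M \<Longrightarrow> \<theta> 0 \<omega> = \<omega>"
    and theta_add: "\<And>n m \<omega>. \<omega> \<in> space M \<Longrightarrow> \<theta> (n + m) \<omega> = \<theta> n (\<theta> m \<omega>)"
    and theta_ergodic:
      "\<And>E. E \<in> sets M \<Longrightarrow> \<theta> 1 -` E \<inter> space M = E \<Longrightarrow> prob E = 0 \<or> prob E = 1"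
    and phi_measurable:
      "(\<lambda>(\<omega>, n, x). \<phi> \<omega> n x) \<in>
         measurable (M \<Otimes>\<^sub>M (count_space UNIV \<Otimes>\<^sub>M count_space UNIV)) (count_space UNIV)"
    and phi_zero: "\<And>\<omega> x. \<omega> \<in> space M \<Longrightarrow> \<phi> \<omega> 0 x = x"
    and phi_cocycle:
      "\<And>\<omega> n m x. \<omega> \<in> space M \<Longrightarrow> \<phi> \<omega> (n + m) x = \<phi> (\<theta> (int m) \<omega>) n (\<phi> \<omega> m x)"
begin

definition sigma_between :: "int \<Rightarrow> int \<Rightarrow> 'w set set" where
  "sigma_between s t = sigma_sets (space M)
     (null_sets M \<union>
      {(\<lambda>\<omega>. \<phi> (\<theta> m \<omega>) n x) -` S \<inter> space M | m n x S. s \<le> m \<and> m + int n \<le> t})"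

definition sigma_past :: "int \<Rightarrow> 'w set set" where
  "sigma_past t = sigma_sets (space M) (\<Union>s\<in>{..<t}. sigma_between s t)"

definition sigma_future :: "int \<Rightarrow> 'w set set" where
  "sigma_future s = sigma_sets (space M) (\<Union>t\<in>{s<..}. sigma_between s t)"

definition markov :: bool where
  "markov \<longleftrightarrow> indep_set (sigma_past 0) (sigma_future 0)"

text \<open>
  The associated Markov chain started in \<open>x\<close> is \<open>X\<^sub>n(\<omega>) = \<phi> \<omega> n x\<close>.  Its \<open>n\<close>-step transition
  probabilities are \<open>trans_prob n x y\<close>; in particular \<open>P(x, y) = trans_prob 1 x y\<close>.
\<close>

definition trans_prob :: "nat \<Rightarrow> 'x \<Rightarrow> 'x \<Rightarrow> real" where
  "trans_prob n x y = prob {\<omega> \<in> space M. \<phi> \<omega> n x = y}"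

definition irreducible :: bool where
  "irreducible \<longleftrightarrow> (\<forall>x y. \<exists>n. trans_prob n x y > 0)"

text \<open>The infimum of the empty set is \<open>\<infinity>\<close>, i.e. the chain never returns.\<close>

definition return_time :: "'x \<Rightarrow> 'w \<Rightarrow> enat" where
  "return_time x \<omega> = Inf (enat ` {n. n \<ge> 1 \<and> \<phi> \<omega> n x = x})"

definition positive_recurrent :: bool where
  "positive_recurrent \<longleftrightarrow>
     (\<forall>x. (\<integral>\<^sup>+ \<omega>. ennreal_of_enat (return_time x \<omega>) \<partial>M) < \<infinity>)"

definition compact_random_set :: "('w \<Rightarrow> 'x set) \<Rightarrow> bool" where
  "compact_random_set B \<longleftrightarrow>
     (\<forall>x. (\<lambda>\<omega>. indicator (B \<omega>) x :: real) \<in> borel_measurable M) \<and>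
     (AE \<omega> in M. finite (B \<omega>))"

definition invariant_compact_random_set :: "('w \<Rightarrow> 'x set) \<Rightarrow> bool" where
  "invariant_compact_random_set B \<longleftrightarrow>
     compact_random_set B \<and> (AE \<omega> in M. \<phi> \<omega> 1 ` B \<omega> = B (\<theta> 1 \<omega>))"

definition forward_attractor :: "('w \<Rightarrow> 'x set) \<Rightarrow> bool" where
  "forward_attractor A \<longleftrightarrow>
     (\<forall>B. compact_random_set B \<longrightarrow>
        (AE \<omega> in M. \<exists>N. \<forall>n\<ge>N. \<phi> \<omega> n ` B \<omega> \<subseteq> A (\<theta> (int n) \<omega>)))"

definition pullback_attractor :: "('w \<Rightarrow> 'x set) \<Rightarrow> bool" where
  "pullback_attractor A \<longleftrightarrow>
     (\<forall>B. finite B \<longrightarrow>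
        (AE \<omega> in M. \<exists>N. \<forall>n\<ge>N. \<phi> (\<theta> (- int n) \<omega>) n ` B \<subseteq> A \<omega>))"

text \<open>
  These properties determine the random attractor up to null sets, so it is treated as a
  predicate on \<open>A\<close>.
\<close>

definition random_attractor :: "('w \<Rightarrow> 'x set) \<Rightarrow> bool" where
  "random_attractor A \<longleftrightarrow>
     invariant_compact_random_set A \<and>
     (\<forall>x. (\<lambda>\<omega>. indicator (A \<omega>) x :: real)
            \<in> borel_measurable (sigma (space M) (sigma_past 0))) \<and>
     forward_attractor A \<and> pullback_attractor A"

definition insulated :: "'x \<Rightarrow> 'x \<Rightarrow> bool" where
  "insulated x y \<longleftrightarrow> (\<forall>n. prob {\<omega> \<in> space M. \<phi> \<omega> n x = \<phi> \<omega> n y} = 0)"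

definition insulated_set :: "'x set \<Rightarrow> bool" where
  "insulated_set K \<longleftrightarrow> (\<forall>x\<in>K. \<forall>y\<in>K. x \<noteq> y \<longrightarrow> insulated x y)"

definition kappa_hat :: enat where
  "kappa_hat = (SUP K\<in>{K. insulated_set K}. set_size K)"

definition maximum_insulated_set :: "'x set \<Rightarrow> bool" where
  "maximum_insulated_set K \<longleftrightarrow> insulated_set K \<and> set_size K = kappa_hat"

end

end

theory Submission
  imports Defs
begin

text \<open>
  The attractor is insulated because it has constant finite size: invariance forces
  \<open>\<phi>\<^sup>n\<^sub>\<omega>\<close> to be injective on \<open>A(\<omega>)\<close>, so the event \<open>x, y \<in> A\<close>, which belongs to the past, is
  almost surely disjoint from the event \<open>\<phi>\<^sup>n(x) = \<phi>\<^sup>n(y)\<close>, which belongs to the future;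
  by independence one of the two is null.  It is maximal because a finite insulated set is mapped
  injectively by every \<open>\<phi>\<^sup>n\<^sub>\<omega>\<close> and is eventually absorbed by \<open>A(\<theta>\<^sub>n\<omega>)\<close>.
\<close>

context rds
begin

lemma phi_random_variable [measurable]: "(\<lambda>\<omega>. \<phi> \<omega> n x) \<in> measurable M (count_space UNIV)"
proof -
  have "(\<lambda>\<omega>. (\<omega>, n, x)) \<in> measurable M (M \<Otimes>\<^sub>M (count_space UNIV \<Otimes>\<^sub>M count_space UNIV))"
    by (intro measurable_Pair measurable_ident_sets measurable_const) (auto simp: space_pair_measure)
  from measurable_comp[OF this phi_measurable] show ?thesis
    by (simp add: o_def)
qed

text \<open>Measure preservation turns an almost sure statement at time 0 into one at any time along
  the orbit, which is how size and invariance of \<open>A\<close> are used at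
  \<open>\<theta> n \<omega>\<close>.\<close>

lemma AE_theta:
  assumes "AE \<omega> in M. P \<omega>"
  shows "AE \<omega> in M. P (\<theta> n \<omega>)"
proof -
  have "AE \<omega> in distr M M (\<theta> n). P \<omega>"
    using assms by (subst theta_preserving)
  then show ?thesis
    by (rule AE_distrD[OF theta_measurable])
qed

lemma sigma_between_sets: "sigma_between s t \<subseteq> sets M"
proof -
  have "(\<lambda>\<omega>. \<phi> (\<theta> m \<omega>) n x) -` S \<inter> space M \<in> sets M" for m n x S
    using measurable_comp[OF theta_measurable phi_random_variable]
    by (auto intro!: measurable_sets simp: o_def)
  then show ?thesis
    unfolding sigma_between_def by (intro sets.sigma_sets_subset) (auto simp: null_sets_def)
qed

lemma sigma_past_sets: "sigma_past t \<subseteq> sets M"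
  unfolding sigma_past_def using sigma_between_sets by (intro sets.sigma_sets_subset) blast

lemma sigma_algebra_sigma_past: "sigma_algebra (space M) (sigma_past t)"
  unfolding sigma_past_def
  by (rule sigma_algebra_sigma_sets) (use sigma_between_sets sets.space_closed in blast)

text \<open>Bridges two encodings: measurability of the attractor refers to a measure space,
  independence to a family of sets.\<close>

lemma sets_sigma_sigma_past: "sets (sigma (space M) (sigma_past t)) = sigma_past t"
  by (rule sigma_algebra.sets_measure_of_eq[OF sigma_algebra_sigma_past])

lemma sigma_algebra_sigma_future: "sigma_algebra (space M) (sigma_future s)"
  unfolding sigma_future_def
  by (rule sigma_algebra_sigma_sets) (use sigma_between_sets sets.space_closed in blast)

lemma phi_vimage_sigma_future: "(\<lambda>\<omega>. \<phi> \<omega> n x) -` S \<inter> space M \<in> sigma_future 0"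
proof -
  have "(\<lambda>\<omega>. \<phi> \<omega> n x) -` S \<inter> space M = (\<lambda>\<omega>. \<phi> (\<theta> 0 \<omega>) n x) -` S \<inter> space M"
    by (auto simp: theta_zero)
  \<comment> \<open>The end point \<open>int n\<close> would fail for \<open>n = 0\<close>, as
    \<open>sigma_future 0\<close> only collects \<open>t > 0\<close>.\<close>
  also have "\<dots> \<in> sigma_between 0 (int n + 1)"
    unfolding sigma_between_def by (rule sigma_sets.Basic) force
  finally show ?thesis
    unfolding sigma_future_def by (intro sigma_sets.Basic) force
qed

text \<open>As the state space is countable, coalescence splits into countably many events, one for
  each common value \<open>z\<close>.\<close>

lemma coalescence_sigma_future: "{\<omega> \<in> space M. \<phi> \<omega> n x = \<phi> \<omega> n y} \<in> sigma_future 0"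
proof -
  interpret F: sigma_algebra "space M" "sigma_future 0"
    by (rule sigma_algebra_sigma_future)
  have "{\<omega> \<in> space M. \<phi> \<omega> n x = \<phi> \<omega> n y} =
      (\<Union>z. ((\<lambda>\<omega>. \<phi> \<omega> n x) -` {z} \<inter> space M) \<inter> ((\<lambda>\<omega>. \<phi> \<omega> n y) -` {z} \<inter> space M))"
    by auto
  also have "\<dots> \<in> sigma_future 0"
    by (intro F.countable_UN'' F.Int phi_vimage_sigma_future) auto
  finally show ?thesis .
qed

lemma attractor_sigma_past:
  assumes "random_attractor A"
  shows "{\<omega> \<in> space M. x \<in> A \<omega>} \<in> sigma_past 0"
proof -
  let ?N = "sigma (space M) (sigma_past 0)"
  have "(\<lambda>\<omega>. indicator (A \<omega>) x :: real) \<in> borel_measurable ?N"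
    using assms by (auto simp: random_attractor_def)
  then have "(\<lambda>\<omega>. indicator (A \<omega>) x :: real) -` {1} \<inter> space ?N \<in> sets ?N"
    by (rule measurable_sets) auto
  moreover have "(\<lambda>\<omega>. indicator (A \<omega>) x :: real) -` {1} \<inter> space ?N = {\<omega> \<in> space M. x \<in> A \<omega>}"
    by (auto simp: indicator_def space_measure_of_conv split: if_splits)
  ultimately show ?thesis
    by (simp add: sets_sigma_sigma_past)
qed

lemma invariant_image:
  assumes "invariant_compact_random_set A"
  shows "AE \<omega> in M. \<forall>n. \<phi> \<omega> n ` A \<omega> = A (\<theta> (int n) \<omega>)"
proof -
  have "AE \<omega> in M. \<phi> \<omega> 1 ` A \<omega> = A (\<theta> 1 \<omega>)"
    using assms by (auto simp: invariant_compact_random_set_def)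
  then have "AE \<omega> in M. \<forall>n. \<phi> (\<theta> (int n) \<omega>) 1 ` A (\<theta> (int n) \<omega>) = A (\<theta> 1 (\<theta> (int n) \<omega>))"
    unfolding AE_all_countable by (intro allI AE_theta)
  then show ?thesis
    using AE_space
  proof eventually_elim
    case (elim \<omega>)
    have "\<phi> \<omega> n ` A \<omega> = A (\<theta> (int n) \<omega>)" for n
    proof (induction n)
      case 0
      then show ?case using elim by (simp add: phi_zero theta_zero)
    next
      case (Suc n)
      \<comment> \<open>The order \<open>1 + n\<close> puts the single step last, at
        \<open>\<theta> (int n) \<omega>\<close>, where one-step invariance is available.\<close>
      have "\<phi> \<omega> (1 + n) ` A \<omega> = \<phi> (\<theta> (int n) \<omega>) 1 ` (\<phi> \<omega> n ` A \<omega>)"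
        using phi_cocycle[OF elim(2), of 1 n] by (simp add: image_image)
      also have "\<dots> = A (\<theta> (1 + int n) \<omega>)"
        using elim Suc.IH by (simp add: theta_add)
      finally show ?case by simp
    qed
    then show ?case by blast
  qed
qed

text \<open>The image of \<open>A \<omega>\<close> under \<open>\<phi> \<omega> n\<close> is the
  attractor at a later time, of the same finite size; a surjection between finite sets of equal size
  is injective.\<close>

lemma invariant_inj_on:
  assumes "invariant_compact_random_set A" and "AE \<omega> in M. set_size (A \<omega>) = enat \<kappa>"
  shows "AE \<omega> in M. \<forall>n. inj_on (\<phi> \<omega> n) (A \<omega>)"
proof -
  have "AE \<omega> in M. \<forall>n. set_size (A (\<theta> (int n) \<omega>)) = enat \<kappa>"
    unfolding AE_all_countable using assms(2) by (intro allI AE_theta)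
  with assms(2) invariant_image[OF assms(1)] show ?thesis
  proof eventually_elim
    case (elim \<omega>)
    show ?case
      using elim by (auto simp: set_size_def split: if_splits intro!: eq_card_imp_inj_on)
  qed
qed

lemma attractor_insulated:
  assumes "markov" and A: "random_attractor A"
    and size: "AE \<omega> in M. set_size (A \<omega>) = enat \<kappa>"
  shows "AE \<omega> in M. insulated_set (A \<omega>)"
proof -
  have inj: "AE \<omega> in M. \<forall>n. inj_on (\<phi> \<omega> n) (A \<omega>)"
    using A size unfolding random_attractor_def by (blast intro: invariant_inj_on)
  let ?E = "\<lambda>x y. {\<omega> \<in> space M. x \<in> A \<omega>} \<inter> {\<omega> \<in> space M. y \<in> A \<omega>}"
  have E_past: "?E x y \<in> sigma_past 0" for x y
  proof -
    interpret P: sigma_algebra "space M" "sigma_past 0"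
      by (rule sigma_algebra_sigma_past)
    show ?thesis
      using attractor_sigma_past[OF A] by (intro P.Int)
  qed
  have "AE \<omega> in M. x \<in> A \<omega> \<and> y \<in> A \<omega> \<longrightarrow> insulated x y" if "x \<noteq> y" for x y
  \<comment> \<open>Either the pair almost surely never lies in \<open>A\<close> together, or the
    event has positive probability and independence forces every coalescence event to be
    null.\<close>
  proof (cases "prob (?E x y) = 0")
    case True
    moreover have "?E x y \<in> sets M"
      using E_past sigma_past_sets by blast
    ultimately have "AE \<omega> in M. \<omega> \<notin> ?E x y"
      by (simp add: prob_eq_0)
    then show ?thesis
      using AE_space by eventually_elim auto
  next
    case False
    have "prob {\<omega> \<in> space M. \<phi> \<omega> n x = \<phi> \<omega> n y} = 0" for n
    proof -
      let ?C = "{\<omega> \<in> space M. \<phi> \<omega> n x = \<phi> \<omega> n y}"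
      have "?E x y \<in> sets M"
        using E_past sigma_past_sets by blast
      moreover have "?C \<in> sets M"
        by measurable
      ultimately have "?E x y \<inter> ?C \<in> sets M"
        by (rule sets.Int)
      moreover have "AE \<omega> in M. \<omega> \<notin> ?E x y \<inter> ?C"
        using inj by eventually_elim (use \<open>x \<noteq> y\<close> in \<open>auto dest: inj_onD\<close>)
      ultimately have "prob (?E x y \<inter> ?C) = 0"
        by (simp add: prob_eq_0)
      moreover have "prob (?E x y \<inter> ?C) = prob (?E x y) * prob ?C"
        using \<open>markov\<close> E_past coalescence_sigma_future
        unfolding markov_def by (rule indep_setD)
      ultimately show ?thesis using False by simp
    qed
    then show ?thesis by (simp add: insulated_def)
  qed
  \<comment> \<open>There are only countably many pairs, so one null set serves them all.\<close>
  then have "AE \<omega> in M. \<forall>x y. x \<noteq> y \<longrightarrow> x \<in> A \<omega> \<and> y \<in> A \<omega> \<longrightarrow> insulated x y"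
    by (simp add: AE_all_countable)
  then show ?thesis
    by eventually_elim (auto simp: insulated_set_def)
qed

text \<open>The failure set is a countable union, over \<open>n\<close>, \<open>x\<close> and
  \<open>y\<close>, of null coalescence events.\<close>

lemma insulated_set_inj_on:
  assumes "insulated_set K"
  shows "AE \<omega> in M. \<forall>n. inj_on (\<phi> \<omega> n) K"
proof -
  have "AE \<omega> in M. x \<in> K \<and> y \<in> K \<and> x \<noteq> y \<longrightarrow> \<phi> \<omega> n x \<noteq> \<phi> \<omega> n y" for x y n
  proof (cases "x \<in> K \<and> y \<in> K \<and> x \<noteq> y")
    case True
    then have "prob {\<omega> \<in> space M. \<phi> \<omega> n x = \<phi> \<omega> n y} = 0"
      using assms by (auto simp: insulated_set_def insulated_def)
    moreover have "{\<omega> \<in> space M. \<phi> \<omega> n x = \<phi> \<omega> n y} \<in> sets M"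
      by measurable
    ultimately have "AE \<omega> in M. \<omega> \<notin> {\<omega> \<in> space M. \<phi> \<omega> n x = \<phi> \<omega> n y}"
      by (simp add: prob_eq_0)
    then show ?thesis
      using AE_space by eventually_elim auto
  qed auto
  then have "AE \<omega> in M. \<forall>n x y. x \<in> K \<and> y \<in> K \<and> x \<noteq> y \<longrightarrow> \<phi> \<omega> n x \<noteq> \<phi> \<omega> n y"
    by (simp add: AE_all_countable)
  then show ?thesis
    by eventually_elim (auto simp: inj_on_def)
qed

lemma finite_insulated_set_card_le:
  assumes "forward_attractor A" and size: "AE \<omega> in M. set_size (A \<omega>) = enat \<kappa>"
    and K: "insulated_set K" "finite K"
  shows "card K \<le> \<kappa>"
proof -
  \<comment> \<open>Viewed as a constant random set, \<open>K\<close> is eventually absorbed by the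
    attractor.\<close>
  have "compact_random_set (\<lambda>_. K)"
    using K by (simp add: compact_random_set_def)
  then have "AE \<omega> in M. \<exists>N. \<forall>n\<ge>N. \<phi> \<omega> n ` K \<subseteq> A (\<theta> (int n) \<omega>)"
    using assms(1) unfolding forward_attractor_def by (elim allE impE)
  moreover have "AE \<omega> in M. \<forall>n. set_size (A (\<theta> (int n) \<omega>)) = enat \<kappa>"
    unfolding AE_all_countable using size by (intro allI AE_theta)
  ultimately have "AE \<omega> in M. card K \<le> \<kappa>"
    using insulated_set_inj_on[OF K(1)]
  proof eventually_elim
    case (elim \<omega>)
    then obtain n where n: "\<phi> \<omega> n ` K \<subseteq> A (\<theta> (int n) \<omega>)" by blast
    have "finite (A (\<theta> (int n) \<omega>))" "card (A (\<theta> (int n) \<omega>)) = \<kappa>"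
      using elim(2) by (auto simp: set_size_def split: if_splits)
    with n elim(3) show ?case by (metis card_image card_mono)
  qed
  \<comment> \<open>The inequality does not depend on \<open>\<omega>\<close>, and on a probability
    space a constant statement that holds almost surely is true.\<close>
  then show ?thesis by simp
qed

lemma insulated_set_size_le:
  assumes "forward_attractor A" and "AE \<omega> in M. set_size (A \<omega>) = enat \<kappa>"
    and K: "insulated_set K"
  shows "set_size K \<le> enat \<kappa>"
proof (cases "finite K")
  case True
  then show ?thesis
    using finite_insulated_set_card_le[OF assms] by (simp add: set_size_def)
next
  case False
  \<comment> \<open>An infinite \<open>K\<close> is ruled out by a finite subset with one point too
    many; insulation passes to subsets.\<close>
  then obtain L where L: "L \<subseteq> K" "finite L" "card L = Suc \<kappa>"
    using infinite_arbitrarily_large by blast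
  then have "insulated_set L"
    using K by (auto simp: insulated_set_def)
  from finite_insulated_set_card_le[OF assms(1,2) this] L show ?thesis by simp
qed

end

theorem theorem3p12:
  fixes M :: "'w measure"
    and \<theta> :: "int \<Rightarrow> 'w \<Rightarrow> 'w"
    and \<phi> :: "'w \<Rightarrow> nat \<Rightarrow> 'x::countable \<Rightarrow> 'x"
    and A :: "'w \<Rightarrow> 'x set"
    and \<kappa> :: nat
  assumes "rds M \<theta> \<phi>"
    and "rds.markov M \<theta> \<phi>"
    and "rds.irreducible M \<phi>"
    and "rds.positive_recurrent M \<phi>"
    and "rds.random_attractor M \<theta> \<phi> A"
    and "AE \<omega> in M. set_size (A \<omega>) = enat \<kappa>"
  shows "(AE \<omega> in M. rds.maximum_insulated_set M \<phi> (A \<omega>)) \<and>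
         enat \<kappa> = rds.kappa_hat M \<phi>"
proof -
  interpret rds M \<theta> \<phi> by fact
  have ins: "AE \<omega> in M. insulated_set (A \<omega>) \<and> set_size (A \<omega>) = enat \<kappa>"
    using attractor_insulated[OF assms(2,5,6)] assms(6) by eventually_elim simp
  \<comment> \<open>The witness is \<open>A \<omega>\<close> for any single good
    \<open>\<omega>\<close>; one exists because the space has mass 1.\<close>
  then have "\<exists>K. insulated_set K \<and> set_size K = enat \<kappa>"
    using eventually_happens[OF ins] by (auto simp: ae_filter_eq_bot_iff emeasure_space_1)
  then have "enat \<kappa> \<le> kappa_hat"
    unfolding kappa_hat_def by (metis SUP_upper mem_Collect_eq)
  moreover have "kappa_hat \<le> enat \<kappa>"
    unfolding kappa_hat_def
    using assms(5,6) by (intro SUP_least) (auto simp: random_attractor_def intro: insulated_set_size_le)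
  ultimately have "enat \<kappa> = kappa_hat" by simp
  with ins show ?thesis by (simp add: maximum_insulated_set_def)
qed

end
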